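(* Let $G$ be a finite ground set with $|G|=m$ and let $S\subseteq G$ be an arbitrary fixed subset with $|S|=m'$. Let $p_1,\dots,p_n\in(0,1)$, let $A_1,\dots,A_n,G_{n+1}$ be drawn from the iterative sampling process $\mathrm{IterSwR}(G,p_1,\dots,p_n)$, and let $\mu:=\sum_{i=1}^n p_i$. Then for every $\epsilon\in[0,1]$, $$\Pr\big[\,|S\setminus G_{n+1}|>(1+\epsilon)\mu m'\,\big]\le \exp\!\left(-\tfrac13\epsilon^2\mu m'\right).$$
   Context: Fixed-probability sampling without replacement $\mathrm{SwR}(B,p)$, for a finite set $B$ and $p\in(0,1)$: let $P$ be a random variable taking values in $\{\lfloor p|B|\rfloor,\lceil p|B|\rceil\}$ with $\mathbb{E}[P]=p|B|$; return a uniformly random subset of $B$ of size $P$. Multi-bucket sampling $\mathrm{MSwR}(G,p)$: initialize $A=\emptyset$, $i=0$, $G_0=G$. While $G_i\neq\emptyset$: choose any (nonempty) subset $B_i\subseteq G_i$ and a $p_i\le p$, draw $A_i\sim\mathrm{SwR}(B_i,p_i)$ (with fresh randomness conditional on the history), set $G_{i+1}=G_i\setminus B_i$, $A\leftarrow A\cup A_i$, $i\leftarrow i+1$. Return $A$. The buckets $B_i$ and probabilities $p_i$ may be chosen adaptively, depending on all previous outcomes. Iterative sampling $\mathrm{IterSwR}(G,p_1,\dots,p_n)$: set $G_1=G$; for $j=1,\dots,n$ draw $A_j$ from an $\mathrm{MSwR}(G_j,p_j)$ process (whose adaptive choices may depend on the whole history) and set $G_{j+1}=G_j\setminus A_j$.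 Return $A_1,\dots,A_n,G_{n+1}$. *)

theory Defs
  imports "HOL-Probability.Probability"
begin

text \<open>The law of the size \<open>P\<close>: it lives on the floor and the ceiling of \<open>x\<close> and has mean \<open>x\<close>.
  These two properties determine it, see \<open>round_pmf_unique\<close>.\<close>

definition round_pmf :: "real \<Rightarrow> nat pmf" where
  "round_pmf x = map_pmf (\<lambda>up. if up then nat \<lceil>x\<rceil> else nat \<lfloor>x\<rfloor>) (bernoulli_pmf (frac x))"

definition SwR :: "'a set \<Rightarrow> real \<Rightarrow> 'a set pmf" where
  "SwR B p = bind_pmf (round_pmf (p * card B)) (\<lambda>k. pmf_of_set {A. A \<subseteq> B \<and> card A = k})"

text \<open>A process with adaptive choices does not have a single law, so \<open>MSwR G p M\<close> says that \<open>M\<close> is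
  the law of the transcript \<open>[(B\<^sub>0, p\<^sub>0, A\<^sub>0), (B\<^sub>1, p\<^sub>1, A\<^sub>1), \<dots>]\<close> of the process on \<open>G\<close> for some way of
  making the choices. The choice \<open>C\<close> of bucket and probability may itself be random (deterministic
  choices being \<open>C = return_pmf (B, q)\<close>); the law \<open>K B q A\<close> of the rest of the process is an arbitrary
  function of what has happened so far.\<close>

inductive MSwR :: "'a set \<Rightarrow> real \<Rightarrow> ('a set \<times> real \<times> 'a set) list pmf \<Rightarrow> bool" where
  stop: "MSwR {} p (return_pmf [])"
| bucket: "MSwR G p (bind_pmf C (\<lambda>(B, q).
     bind_pmf (SwR B q) (\<lambda>A. map_pmf (\<lambda>t. (B, q, A) # t) (K B q A))))"
  if "G \<noteq> {}"
    and "\<And>B q. (B, q) \<in> set_pmf C \<Longrightarrow> B \<noteq> {} \<and> B \<subseteq> G \<and> 0 < q \<and> q \<le> p"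
    and "\<And>B q A. (B, q) \<in> set_pmf C \<Longrightarrow> A \<in> set_pmf (SwR B q) \<Longrightarrow> MSwR (G - B) p (K B q A)"

definition returned :: "('a set \<times> real \<times> 'a set) list \<Rightarrow> 'a set" where
  "returned t = (\<Union>(B, q, A) \<in> set t. A)"

text \<open>Similarly, \<open>IterSwR G [p\<^sub>1, \<dots>, p\<^sub>n] D\<close> says that \<open>D\<close> is the law of \<open>([A\<^sub>1, \<dots>, A\<^sub>n], G\<^bsub>n+1\<^esub>)\<close> for
  some way of making the choices. Later rounds may depend on the full transcript of the earlier
  ones, not just on the returned sets.\<close>

inductive IterSwR :: "'a set \<Rightarrow> real list \<Rightarrow> ('a set list \<times> 'a set) pmf \<Rightarrow> bool" where
  finish: "IterSwR G [] (return_pmf ([], G))"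
| round: "IterSwR G (p # ps)
     (bind_pmf M (\<lambda>t. map_pmf (\<lambda>(As, R). (returned t # As, R)) (K t)))"
  if "MSwR G p M"
    and "\<And>t. t \<in> set_pmf M \<Longrightarrow> IterSwR (G - returned t) ps (K t)"

lemma set_round_pmf: "set_pmf (round_pmf x) \<subseteq> {nat \<lfloor>x\<rfloor>, nat \<lceil>x\<rceil>}"
  by (auto simp: round_pmf_def)

lemma expectation_round_pmf:
  assumes "0 \<le> x"
  shows "measure_pmf.expectation (round_pmf x) real = x"
proof -
  have "measure_pmf.expectation (round_pmf x) real
      = frac x * nat \<lceil>x\<rceil> + (1 - frac x) * nat \<lfloor>x\<rfloor>"
    by (simp add: round_pmf_def frac_lt_1 less_imp_le mult.commute)
  also have "\<dots> = x"
  proof (cases "x \<in> \<int>")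
    case True
    then show ?thesis using assms by (auto elim!: Ints_cases)
  next
    case False
    then have "\<lceil>x\<rceil> = \<lfloor>x\<rfloor> + 1"
      by (metis ceiling_altdef Ints_of_int)
    with assms show ?thesis by (simp add: frac_def algebra_simps)
  qed
  finally show ?thesis .
qed

lemma round_pmf_unique:
  assumes "0 \<le> x" and "set_pmf P \<subseteq> {nat \<lfloor>x\<rfloor>, nat \<lceil>x\<rceil>}"
    and "measure_pmf.expectation P real = x"
  shows "P = round_pmf x"
proof -
  let ?l = "nat \<lfloor>x\<rfloor>" and ?u = "nat \<lceil>x\<rceil>"
  show ?thesis
  proof (cases "?l = ?u")
    case True
    then have "set_pmf P \<subseteq> {?l}" "set_pmf (round_pmf x) \<subseteq> {?l}"
      using assms(2) set_round_pmf[of x] by auto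
    then show ?thesis by (metis set_pmf_subset_singleton)
  next
    case False
    have *: "pmf Q ?l = pmf R ?l \<and> pmf Q ?u = pmf R ?u"
      if Q: "set_pmf Q \<subseteq> {?l, ?u}" "measure_pmf.expectation Q real = x"
        and R: "set_pmf R \<subseteq> {?l, ?u}" "measure_pmf.expectation R real = x" for Q R
    proof -
      have s: "pmf Q ?l + pmf Q ?u = 1" "real ?l * pmf Q ?l + real ?u * pmf Q ?u = x"
        if "set_pmf Q \<subseteq> {?l, ?u}" "measure_pmf.expectation Q real = x" for Q
      proof -
        show "pmf Q ?l + pmf Q ?u = 1"
          using sum_pmf_eq_1[of "{?l, ?u}" Q] that False by simp
        have "measure_pmf.expectation Q real = (\<Sum>k\<in>{?l, ?u}. pmf Q k *\<^sub>R real k)"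
          using that(1) by (intro integral_measure_pmf) auto
        also have "\<dots> = real ?l * pmf Q ?l + real ?u * pmf Q ?u"
          unfolding real_scaleR_def using False
          by (simp only: sum.insert finite.intros empty_iff insert_iff sum.empty mult.commute) simp
        finally show "real ?l * pmf Q ?l + real ?u * pmf Q ?u = x"
          using that(2) by simp
      qed
      have "(real ?u - real ?l) * (pmf Q ?u - pmf R ?u) = 0"
        using s[OF Q] s[OF R] by algebra
      then show ?thesis using s(1)[OF Q] s(1)[OF R] False by simp
    qed
    show ?thesis
    proof (rule pmf_eqI)
      fix i
      show "pmf P i = pmf (round_pmf x) i"
        using *[OF assms(2,3) set_round_pmf expectation_round_pmf[OF assms(1)]]
          assms(2) set_round_pmf[of x]
        by (metis empty_iff insert_iff pmf_eq_0_set_pmf subset_iff)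
    qed
  qed
qed

lemma MSwR_exists:
  assumes "finite G" "0 < p"
  shows "\<exists>M. MSwR G p M"
proof (cases "G = {}")
  case False
  have "MSwR G p (bind_pmf (return_pmf (G, p)) (\<lambda>(B, q).
      bind_pmf (SwR B q) (\<lambda>A. map_pmf (\<lambda>t. (B, q, A) # t) (return_pmf []))))"
    using False assms by (intro MSwR.bucket) (auto intro: MSwR.stop)
  then show ?thesis by blast
qed (auto intro: MSwR.stop)

lemma IterSwR_exists:
  assumes "finite G" "\<forall>p\<in>set ps. 0 < p"
  shows "\<exists>D. IterSwR G ps D"
  using assms
proof (induction ps arbitrary: G)
  case (Cons p ps)
  obtain M where M: "MSwR G p M" using MSwR_exists Cons.prems by force
  have "\<forall>t. \<exists>D. IterSwR (G - returned t) ps D" using Cons by simp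
  then obtain K where "\<And>t. IterSwR (G - returned t) ps (K t)" by metis
  with M show ?case by (blast intro: IterSwR.round)
qed (auto intro: IterSwR.finish)

end

(*
  A set U is contained in a SwR(B, q) sample with probability at most q^|U|, and this survives
  the adaptive bucketing of MSwR because the buckets are disjoint. Expanding
  x^|S \<inter> A| = \<Sum>_{U \<subseteq> S \<inter> A} (x - 1)^|U| turns it into the bound (1 + p (x - 1))^|S| on the
  generating function of one round, as for independent sampling. Over several rounds, backward
  induction gives E[c^|S - R|] \<le> F^|S|: if F bounds the later rounds, the current round, with
  weight c on removed and F on surviving elements, contributes F (1 + p (c/F - 1)) per element.
  Here F stays between 1 and c, so x = c/F \<ge> 1 is admissible, and F \<le> 1 + (c - 1) \<mu>.
  Markov's inequality with c = 1 + \<epsilon> finishes the proof.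
*)

theory Submission
  imports Defs
begin

section \<open>Containment probabilities of uniform subsets, at one size and between adjacent
  sizes\<close>

text \<open>Multiply out the product of \<open>1 + y\<close> over \<open>W\<close>: each subset
  \<open>U\<close> arises from picking \<open>y\<close> exactly on \<open>U\<close>.\<close>

lemma sum_power_card_Pow:
  fixes y :: "'b::comm_semiring_1"
  assumes "finite W"
  shows "(\<Sum>U\<in>Pow W. y ^ card U) = (1 + y) ^ card W"
  using prod_add[OF assms, of "\<lambda>_. y" "\<lambda>_. 1"] by (simp add: add.commute)

text \<open>Deleting \<open>U\<close> is a bijection onto the subsets of \<open>B - U\<close> of
  size \<open>k - card U\<close>. With \<open>card U > k\<close> the truncated subtraction would
  make the right side 1 instead of 0.\<close>

lemma card_supersets:
  assumes "finite B" "U \<subseteq> B" "card U \<le> k"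
  shows "card {A. A \<subseteq> B \<and> card A = k \<and> U \<subseteq> A} = (card B - card U) choose (k - card U)"
proof -
  have U: "finite U" using assms finite_subset by blast
  have "bij_betw (\<lambda>A. A - U) {A. A \<subseteq> B \<and> card A = k \<and> U \<subseteq> A} {A. A \<subseteq> B - U \<and> card A = k - card U}"
  proof (rule bij_betw_byWitness[where f' = "\<lambda>A. A \<union> U"])
    show "(\<lambda>A. A \<union> U) ` {A. A \<subseteq> B - U \<and> card A = k - card U} \<subseteq> {A. A \<subseteq> B \<and> card A = k \<and> U \<subseteq> A}"
    proof clarify
      fix A assume A: "A \<subseteq> B - U" "card A = k - card U"
      then have "card (A \<union> U) = k"
        using assms U by (subst card_Un_disjoint) (auto intro: finite_subset)
      then show "A \<union> U \<subseteq> B \<and> card (A \<union> U) = k \<and> U \<subseteq> A \<union> U" using A assms by auto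
    qed
  qed (use U in \<open>auto simp: card_Diff_subset\<close>)
  then have "card {A. A \<subseteq> B \<and> card A = k \<and> U \<subseteq> A} = card {A. A \<subseteq> B - U \<and> card A = k - card U}"
    by (rule bij_betw_same_card)
  also have "\<dots> = (card (B - U)) choose (k - card U)"
    using assms by (intro n_subsets) auto
  finally show ?thesis using U assms by (simp add: card_Diff_subset)
qed

text \<open>Absorption supplies one factor per step. The product form suits induction on
  \<open>u\<close> and, unlike the quotient, also gives the right value 0 for
  \<open>u > k\<close>.\<close>

lemma binomial_quotient_eq_prod:
  assumes "k \<le> N" "u \<le> k"
  shows "real ((N - u) choose (k - u)) / real (N choose k) = (\<Prod>i<u. (real k - real i) / (real N - real i))"
  using assms(2)
proof (induction u)
  case 0
  then show ?case using assms by simp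
next
  case (Suc u)
  have "(k - u) * ((N - u) choose (k - u)) = (N - u) * ((N - Suc u) choose (k - Suc u))"
    using binomial_absorption[of "k - Suc u" "N - u"] Suc.prems assms
    by (simp add: Suc_diff_Suc)
  then have "real (k - u) * real ((N - u) choose (k - u)) = real (N - u) * real ((N - Suc u) choose (k - Suc u))"
    by (metis of_nat_mult)
  then have "real ((N - Suc u) choose (k - Suc u)) = real ((N - u) choose (k - u)) * ((real k - u) / (real N - u))"
    using Suc.prems assms by (simp add: of_nat_diff field_simps)
  then have "real ((N - Suc u) choose (k - Suc u)) / real (N choose k)
      = real ((N - u) choose (k - u)) / real (N choose k) * ((real k - u) / (real N - u))"
    by simp
  then show ?case using Suc by simp
qed

lemma prob_superset_pmf_of_set:
  assumes "finite B" "U \<subseteq> B" "k \<le> card B"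
  shows "measure_pmf.prob (pmf_of_set {A. A \<subseteq> B \<and> card A = k}) {A. U \<subseteq> A}
       = (\<Prod>i<card U. (real k - real i) / (real (card B) - real i))"
proof -
  let ?X = "{A. A \<subseteq> B \<and> card A = k}"
  have fin: "finite ?X" using assms by simp
  have c: "card ?X = card B choose k" using n_subsets[OF assms(1)] .
  then have "?X \<noteq> {}" using assms by (metis binomial_eq_0_iff card.empty leD)
  then have "measure_pmf.prob (pmf_of_set ?X) {A. U \<subseteq> A} = card (?X \<inter> {A. U \<subseteq> A}) / card ?X"
    using fin by (rule measure_pmf_of_set)
  moreover have "?X \<inter> {A. U \<subseteq> A} = {A. A \<subseteq> B \<and> card A = k \<and> U \<subseteq> A}" by auto
  ultimately have eq: "measure_pmf.prob (pmf_of_set ?X) {A. U \<subseteq> A}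
      = card {A. A \<subseteq> B \<and> card A = k \<and> U \<subseteq> A} / (card B choose k)"
    using c by simp
  show ?thesis
  proof (cases "card U \<le> k")
    case True
    then show ?thesis using eq card_supersets[OF assms(1,2)] binomial_quotient_eq_prod[OF assms(3)] by simp
  next
    case False
    have none: "{A. A \<subseteq> B \<and> card A = k \<and> U \<subseteq> A} = {}"
      using False assms by (auto dest: card_mono[rotated] finite_subset)
    have "measure_pmf.prob (pmf_of_set ?X) {A. U \<subseteq> A} = 0" unfolding eq none by simp
    \<comment> \<open>The factor at \<open>i = k\<close> vanishes.\<close>
    moreover have "(\<Prod>i<card U. (real k - real i) / (real (card B) - real i)) = 0"
      using False by (intro prod_zero) auto
    ultimately show ?thesis by simp
  qed
qed

text \<open>\<open>w u k\<close> is the probability that a uniform \<open>k\<close>-subset of an \<open>N\<close>-set contains a given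
  \<open>u\<close>-subset. Bounding it by \<open>(k / N)\<^sup>u\<close> before averaging over the randomly rounded size would
  lose the result, since \<open>(k / N)\<^sup>u\<close> is convex in \<open>k\<close>.\<close>

lemma ffact_interpolation_step:
  fixes f :: real and l u N :: nat
  assumes f: "0 \<le> f" "f < 1" and le: "real l + f \<le> N" and u: "u < N"
  defines "w \<equiv> \<lambda>u k. \<Prod>i<u. (real k - real i) / (real N - real i)"
  shows "(1 - f) * w (Suc u) l + f * w (Suc u) (Suc l)
       \<le> (real l + f) / N * ((1 - f) * w u l + f * w u (Suc l))"
proof -
  \<comment> \<open>Raising \<open>k\<close> from \<open>l\<close> to \<open>l + 1\<close> shifts
    the falling factorial, so all but the end factors cancel. Without division the identity also
    holds at \<open>u = l + 1\<close>.\<close>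
  have shift: "w u (Suc l) * (real l + 1 - u) = (real l + 1) * w u l" for u
  proof (induction u)
    case (Suc u)
    have "w (Suc u) (Suc l) * (real l + 1 - Suc u)
        = w u (Suc l) * ((real l + 1 - u) / (real N - u)) * (real l - u)"
      by (simp add: w_def)
    also have "\<dots> = w u (Suc l) * (real l + 1 - u) * ((real l - u) / (real N - u))"
      by simp
    also have "\<dots> = (real l + 1) * w (Suc u) l"
      unfolding Suc by (simp add: w_def)
    finally show ?case .
  qed (simp add: w_def)
  have N: "0 < real N" "0 < real N - u" using u by auto
  have ws: "w (Suc u) k = w u k * ((real k - u) / (real N - u))" for k
    by (simp add: w_def)
  have w0: "w u k = 0" if "k < u" for k
    unfolding w_def using that by (intro prod_zero) auto
  have wnn: "0 \<le> w u k" for k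
  proof (cases "k < u")
    case False
    then show ?thesis unfolding w_def using u by (intro prod_nonneg) auto
  qed (simp add: w0)
  \<comment> \<open>For \<open>u > l + 1\<close> everything vanishes. For \<open>u = l + 1\<close>
    the left side vanishes and the right side is nonnegative. Only \<open>u \<le> l\<close> needs
    the computation.\<close>
  consider "Suc l < u" | "Suc l = u" | "u \<le> l" by linarith
  then show ?thesis
  proof cases
    case 1
    then show ?thesis by (simp add: ws w0)
  next
    case 2
    have "0 \<le> (real l + f) / N * (f * w u (Suc l))"
      using f wnn N by simp
    then show ?thesis using 2 by (simp add: ws w0)
  next
    case 3
    define a where "a = real l - u"
    \<comment> \<open>A common unit: both \<open>w u l\<close> and \<open>w u (Suc l)\<close> become
      polynomial multiples of \<open>v\<close>.\<close>
    define v where "v = w u l / (a + 1)"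
    have a: "0 \<le> a" using 3 by (simp add: a_def)
    have v: "0 \<le> v" using a wnn by (simp add: v_def)
    have wl: "w u l = (a + 1) * v" using a by (simp add: v_def)
    have "w u (Suc l) * (a + 1) = (real l + 1) * (a + 1) * v"
      using shift[of u] wl by (simp add: a_def algebra_simps)
    then have wl': "w u (Suc l) = (real l + 1) * v" using a by simp
    have l: "real l = a + u" by (simp add: a_def)
    \<comment> \<open>The claim after cancelling \<open>v\<close> and clearing the denominators
      \<open>N\<close> and \<open>N - u\<close>. The case \<open>f = 0\<close> is separate because
      \<open>l = N\<close> is possible there, which would make \<open>d\<close> below
      negative.\<close>
    have key: "(a + 1) * (a + f * (u + 1)) * N \<le> (real l + f) * (a + 1 + f * u) * (real N - u)"
    proof (cases "f = 0")
      case True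
      have "0 \<le> (a + 1) * (u * (N - real l))" using a le True by simp
      then show ?thesis using True by (simp add: l algebra_simps)
    next
      case False
      define d where "d = real N - real l - 1"
      have "real l < real N" using f le False by linarith
      then have d: "0 \<le> d" by (simp add: d_def)
      have fu: "0 \<le> f * u" using f by simp
      have "f * (1 - f) \<le> 1" using f by (intro mult_le_one) auto
      then have "0 \<le> d * (a + 1 + f * u - f * (1 - f))" using a d fu by (intro mult_nonneg_nonneg) linarith+
      moreover have "0 \<le> (1 - f) * ((a + 1) * (1 - f))" using a f by simp
      \<comment> \<open>This expression is the difference of the two sides of \<open>key\<close>,
        arranged so that its sign is visible.\<close>
      ultimately have "0 \<le> u * ((1 - f) * ((a + 1) * (1 - f)) + d * (a + 1 + f * u - f * (1 - f)))"
        by simp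
      also have "\<dots> = (real l + f) * (a + 1 + f * u) * (real N - u) - (a + 1) * (a + f * (u + 1)) * N"
      proof -
        have "real N = a + u + 1 + d" by (simp add: d_def l)
        show ?thesis unfolding l \<open>real N = _\<close> of_nat_add of_nat_1 by algebra
      qed
      finally show ?thesis by simp
    qed
    have "(1 - f) * w (Suc u) l + f * w (Suc u) (Suc l)
        = v * ((a + 1) * (a + f * (u + 1)) / (real N - u))"
    proof -
      have "real l - u = a" "real (Suc l) - u = a + 1" by (simp_all add: l)
      then have "(1 - f) * w (Suc u) l + f * w (Suc u) (Suc l)
          = ((1 - f) * ((a + 1) * v * a) + f * ((real l + 1) * v * (a + 1))) / (real N - u)"
        unfolding ws wl wl' by (simp add: add_divide_distrib)
      also have "(1 - f) * ((a + 1) * v * a) + f * ((real l + 1) * v * (a + 1))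
          = v * ((a + 1) * (a + f * (u + 1)))"
        by (simp add: l algebra_simps)
      finally show ?thesis by simp
    qed
    also have "\<dots> \<le> v * ((real l + f) * (a + 1 + f * u) / N)"
      using key v N by (intro mult_left_mono) (simp add: field_simps)
    also have "\<dots> = (real l + f) / N * ((1 - f) * w u l + f * w u (Suc l))"
      unfolding wl wl' using l N by (simp add: field_simps)
    finally show ?thesis .
  qed
qed

section \<open>One bucket: the law \<open>SwR\<close>\<close>

lemma prob_bernoulli_bind:
  assumes "0 \<le> p" "p \<le> 1"
  shows "measure_pmf.prob (bind_pmf (bernoulli_pmf p) f) X
       = p * measure_pmf.prob (f True) X + (1 - p) * measure_pmf.prob (f False) X"
proof -
  have "ennreal (measure_pmf.prob (bind_pmf (bernoulli_pmf p) f) X)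
      = ennreal (p * measure_pmf.prob (f True) X + (1 - p) * measure_pmf.prob (f False) X)"
    using assms
    by (simp add: measure_pmf.emeasure_eq_measure[symmetric] emeasure_bind_pmf ennreal_mult ennreal_plus)
       (simp add: measure_pmf.emeasure_eq_measure ennreal_mult mult.commute)
  then show ?thesis using assms by (subst (asm) ennreal_inj) auto
qed

text \<open>Condition on the rounding, insert the exact probabilities for the two sizes, and induct
  on the size of the contained set: by the interpolation step each further element costs at most a
  factor \<open>x / N = q\<close>.\<close>

lemma prob_superset_SwR:
  assumes "finite B" "U \<subseteq> B" "0 \<le> q" "q \<le> 1"
  shows "measure_pmf.prob (SwR B q) {A. U \<subseteq> A} \<le> q ^ card U"
proof -
  define N where "N = card B"
  define x where "x = q * N"
  define l where "l = nat \<lfloor>x\<rfloor>"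
  define f where "f = frac x"
  define w where "w = (\<lambda>u k. \<Prod>i<u. (real k - real i) / (real N - real i))"
  have x: "0 \<le> x" "x \<le> N" using assms mult_left_le_one_le[of N q] by (auto simp: x_def)
  have f: "0 \<le> f" "f < 1" by (auto simp: f_def frac_lt_1)
  have l: "real l + f = x" using x by (simp add: l_def f_def frac_def)
  have lN: "l \<le> N" using l f x by linarith
  \<comment> \<open>If \<open>f = 0\<close>, then \<open>Suc l\<close> may exceed \<open>N\<close>
    and the ceiling is \<open>l\<close> itself, but the term with \<open>Suc l\<close> then has
    weight 0.\<close>
  have SuclN: "Suc l \<le> N" if "f \<noteq> 0" using that l f x by linarith
  have up: "nat \<lceil>x\<rceil> = Suc l" if "f \<noteq> 0"
  proof -
    have "x \<notin> \<int>" using that by (simp add: f_def)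
    then have "\<lceil>x\<rceil> = \<lfloor>x\<rfloor> + 1" by (metis ceiling_altdef Ints_of_int)
    then show ?thesis using x by (simp add: l_def nat_add_distrib)
  qed
  have bound: "(1 - f) * w u l + f * w u (Suc l) \<le> q ^ u" if "u \<le> N" for u
    using that
  proof (induction u)
    case (Suc u)
    have "(1 - f) * w (Suc u) l + f * w (Suc u) (Suc l)
        \<le> (real l + f) / N * ((1 - f) * w u l + f * w u (Suc l))"
      unfolding w_def using Suc.prems f l x by (intro ffact_interpolation_step) auto
    also have "(real l + f) / N = q" using Suc.prems by (simp add: l x_def)
    also have "q * ((1 - f) * w u l + f * w u (Suc l)) \<le> q * q ^ u"
      using Suc assms by (intro mult_left_mono) auto
    finally show ?case by simp
  qed (simp add: w_def)
  have "measure_pmf.prob (SwR B q) {A. U \<subseteq> A}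
      = f * measure_pmf.prob (pmf_of_set {A. A \<subseteq> B \<and> card A = nat \<lceil>x\<rceil>}) {A. U \<subseteq> A}
      + (1 - f) * measure_pmf.prob (pmf_of_set {A. A \<subseteq> B \<and> card A = l}) {A. U \<subseteq> A}"
    using f unfolding SwR_def round_pmf_def bind_map_pmf N_def[symmetric] x_def[symmetric]
    by (subst prob_bernoulli_bind) (simp_all add: f_def l_def)
  also have "\<dots> = (1 - f) * w (card U) l + f * w (card U) (Suc l)"
    using lN SuclN up assms
    by (cases "f = 0") (simp_all add: prob_superset_pmf_of_set N_def w_def)
  also have "\<dots> \<le> q ^ card U"
    using assms by (intro bound) (simp add: N_def card_mono)
  finally show ?thesis .
qed

text \<open>The support of \<open>pmf_of_set\<close> is as expected only for a nonempty finite set,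
  so the rounded size must be at most \<open>card B\<close>; this is where \<open>q \<le> 1\<close>
  enters.\<close>

lemma SwR_subset:
  assumes "finite B" "0 \<le> q" "q \<le> 1" "A \<in> set_pmf (SwR B q)"
  shows "A \<subseteq> B"
proof -
  obtain k where k: "k \<in> set_pmf (round_pmf (q * card B))"
    and A: "A \<in> set_pmf (pmf_of_set {A. A \<subseteq> B \<and> card A = k})"
    using assms(4) by (auto simp: SwR_def)
  have "q * card B \<le> card B" using assms mult_left_le_one_le[of "card B" q] by simp
  then have "\<lceil>q * card B\<rceil> \<le> int (card B)" by (simp add: ceiling_le_iff)
  moreover have "\<lfloor>q * card B\<rfloor> \<le> \<lceil>q * card B\<rceil>" by (rule floor_le_ceiling)
  moreover have "k = nat \<lfloor>q * card B\<rfloor> \<or> k = nat \<lceil>q * card B\<rceil>"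
    using k set_round_pmf[of "q * card B"] by blast
  ultimately have "k \<le> card B" by (metis nat_le_iff order_trans)
  then have "card {A. A \<subseteq> B \<and> card A = k} \<noteq> 0" using n_subsets[OF assms(1), of k] by simp
  then have "{A. A \<subseteq> B \<and> card A = k} \<noteq> {}" by (metis card.empty)
  then show ?thesis using A assms(1) by (subst (asm) set_pmf_of_set) auto
qed

section \<open>One round: adaptive buckets\<close>

lemma returned_simps [simp]:
  "returned [] = {}" "returned ((B, q, A) # t) = A \<union> returned t"
  by (auto simp: returned_def)

text \<open>This separates the buckets: what follows a bucket \<open>B\<close> returns only elements
  of \<open>G - B\<close>, so elements of \<open>B\<close> can be returned only by the sample from
  \<open>B\<close>.\<close>

lemma MSwR_returned_subset:
  assumes "MSwR G p M" "finite G" "p \<le> 1" "t \<in> set_pmf M"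
  shows "returned t \<subseteq> G"
  using assms
proof (induction arbitrary: t rule: MSwR.induct)
  case (bucket G C p K)
  from bucket.prems(3) obtain B q A t' where *: "(B, q) \<in> set_pmf C" "A \<in> set_pmf (SwR B q)"
    "t' \<in> set_pmf (K B q A)" "t = (B, q, A) # t'"
    by auto
  have "B \<subseteq> G" "0 < q" "q \<le> p" using bucket.hyps(2)[OF *(1)] by auto
  then have "A \<subseteq> B" using bucket.prems * by (intro SwR_subset) (auto intro: finite_subset)
  moreover have "returned t' \<subseteq> G - B" using * bucket by auto
  ultimately show ?case using * \<open>B \<subseteq> G\<close> by auto
qed auto

text \<open>Removes the randomness of the adaptive choices: a bound valid for every choice is valid
  on average.\<close>

lemma nn_integral_pmf_le_const:
  assumes "\<And>x. x \<in> set_pmf M \<Longrightarrow> f x \<le> c"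
  shows "(\<integral>\<^sup>+x. f x \<partial>measure_pmf M) \<le> c"
proof -
  have "(\<integral>\<^sup>+x. f x \<partial>measure_pmf M) \<le> (\<integral>\<^sup>+x. c \<partial>measure_pmf M)"
    using assms by (intro nn_integral_mono_AE) (auto simp: AE_measure_pmf_iff)
  then show ?thesis by simp
qed

text \<open>The sample from the first bucket must cover \<open>U \<inter> B\<close> and the rest of
  the process must cover \<open>U - B\<close>. The induction hypothesis bounds the latter by
  \<open>p ^ card (U - B)\<close> whatever \<open>B\<close>, \<open>q\<close> and \<open>A\<close>
  were, so the two bounds multiply despite adaptivity.\<close>

lemma emeasure_superset_MSwR:
  assumes "MSwR G p M" "finite G" "p \<le> 1" "U \<subseteq> G"
  shows "emeasure M {t. U \<subseteq> returned t} \<le> ennreal (p ^ card U)"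
  using assms
proof (induction arbitrary: U rule: MSwR.induct)
  case (stop p)
  then show ?case by simp
next
  case (bucket G C p K)
  show ?case
    unfolding emeasure_bind_pmf
  proof (intro nn_integral_pmf_le_const, clarify, unfold emeasure_bind_pmf)
    fix B q assume Bq: "(B, q) \<in> set_pmf C"
    note h = bucket.hyps(2)[OF Bq]
    have fin: "finite B" "finite U" using h bucket.prems finite_subset by blast+
    have "(\<integral>\<^sup>+A. emeasure (map_pmf ((#) (B, q, A)) (K B q A)) {t. U \<subseteq> returned t} \<partial>SwR B q)
        \<le> (\<integral>\<^sup>+A. indicator {A. U \<inter> B \<subseteq> A} A * ennreal (p ^ card (U - B)) \<partial>SwR B q)"
    proof (intro nn_integral_mono_AE, unfold AE_measure_pmf_iff, intro ballI)
      fix A assume A: "A \<in> set_pmf (SwR B q)"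
      have AB: "A \<subseteq> B" using SwR_subset[OF fin(1) _ _ A] h bucket.prems by auto
      have sub: "returned t \<subseteq> G - B" if "t \<in> set_pmf (K B q A)" for t
        using MSwR_returned_subset[OF bucket.hyps(3)[OF Bq A]] that bucket.prems by auto
      have "emeasure (map_pmf ((#) (B, q, A)) (K B q A)) {t. U \<subseteq> returned t}
          = emeasure (K B q A) ({t. U \<subseteq> A \<union> returned t} \<inter> set_pmf (K B q A))"
        by (simp add: vimage_def emeasure_Int_set_pmf)
      also have "\<dots> \<le> indicator {A. U \<inter> B \<subseteq> A} A * ennreal (p ^ card (U - B))"
      proof (cases "U \<inter> B \<subseteq> A")
        case True
        have "emeasure (K B q A) ({t. U \<subseteq> A \<union> returned t} \<inter> set_pmf (K B q A))
            \<le> emeasure (K B q A) {t. U - B \<subseteq> returned t}"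
          using AB by (intro emeasure_mono) auto
        also have "\<dots> \<le> ennreal (p ^ card (U - B))"
          using bucket.prems by (intro bucket.IH[OF Bq A]) auto
        finally show ?thesis using True by simp
      next
        case False
        \<comment> \<open>An element of \<open>U \<inter> B\<close> missed by \<open>A\<close>
          cannot be returned later.\<close>
        then have "{t. U \<subseteq> A \<union> returned t} \<inter> set_pmf (K B q A) = {}" using sub by auto
        then show ?thesis by simp
      qed
      finally show "emeasure (map_pmf ((#) (B, q, A)) (K B q A)) {t. U \<subseteq> returned t}
          \<le> indicator {A. U \<inter> B \<subseteq> A} A * ennreal (p ^ card (U - B))" .
    qed
    also have "\<dots> = ennreal (measure_pmf.prob (SwR B q) {A. U \<inter> B \<subseteq> A}) * ennreal (p ^ card (U - B))"
      by (simp add: nn_integral_multc measure_pmf.emeasure_eq_measure)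
    also have "\<dots> \<le> ennreal (q ^ card (U \<inter> B)) * ennreal (p ^ card (U - B))"
      using h fin bucket.prems by (intro mult_right_mono ennreal_leI prob_superset_SwR) auto
    also have "\<dots> \<le> ennreal (p ^ card (U \<inter> B)) * ennreal (p ^ card (U - B))"
      using h by (intro mult_right_mono ennreal_leI power_mono) auto
    also have "\<dots> = ennreal (p ^ (card (U \<inter> B) + card (U - B)))"
      using h by (simp add: power_add ennreal_mult)
    also have "card (U \<inter> B) + card (U - B) = card U"
      using fin by (metis Diff_Int2 card_Int_Diff)
    finally show "(\<integral>\<^sup>+A. emeasure (map_pmf ((#) (B, q, A)) (K B q A)) {t. U \<subseteq> returned t} \<partial>SwR B q)
        \<le> ennreal (p ^ card U)" .
  qed
qed

text \<open>With \<open>1 \<le> x\<close> the coefficients \<open>(x - 1) ^ card U\<close> of the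
  subset expansion are nonnegative, so upper bounds on the containment probabilities can be inserted
  term by term.\<close>

lemma MSwR_mgf_bound:
  assumes "MSwR G p M" "finite G" "0 \<le> p" "p \<le> 1" "S \<subseteq> G" "1 \<le> x"
  shows "(\<integral>\<^sup>+t. ennreal (x ^ card (S \<inter> returned t)) \<partial>M) \<le> ennreal ((1 + p * (x - 1)) ^ card S)"
proof -
  have fin: "finite S" using assms finite_subset by blast
  have expand: "ennreal (x ^ card (S \<inter> W))
      = (\<Sum>U\<in>Pow S. ennreal ((x - 1) ^ card U) * indicator {t. U \<subseteq> returned t} t)"
    if "W = returned t" for W t
  proof -
    have "x ^ card (S \<inter> W) = (\<Sum>U\<in>Pow (S \<inter> W). (x - 1) ^ card U)"
      using fin by (subst sum_power_card_Pow) auto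
    also have "\<dots> = (\<Sum>U\<in>Pow S. (x - 1) ^ card U * indicator {t. U \<subseteq> returned t} t)"
      using fin that by (intro sum.mono_neutral_cong_left) (auto simp: indicator_def)
    finally show ?thesis
      using assms by (simp add: sum_ennreal[symmetric] ennreal_mult ennreal_indicator)
  qed
  have "(\<integral>\<^sup>+t. ennreal (x ^ card (S \<inter> returned t)) \<partial>M)
      = (\<Sum>U\<in>Pow S. ennreal ((x - 1) ^ card U) * emeasure M {t. U \<subseteq> returned t})"
    by (simp add: expand nn_integral_sum nn_integral_cmult)
  also have "\<dots> \<le> (\<Sum>U\<in>Pow S. ennreal ((x - 1) ^ card U) * ennreal (p ^ card U))"
    using assms by (intro sum_mono mult_left_mono emeasure_superset_MSwR[OF assms(1)]) auto
  also have "\<dots> = ennreal (\<Sum>U\<in>Pow S. (p * (x - 1)) ^ card U)"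
  proof -
    have "ennreal ((x - 1) ^ card U) * ennreal (p ^ card U) = ennreal ((p * (x - 1)) ^ card U)" for U
      using assms by (simp add: ennreal_mult mult.commute[of "ennreal (p ^ card U)"] power_mult_distrib)
    then have "(\<Sum>U\<in>Pow S. ennreal ((x - 1) ^ card U) * ennreal (p ^ card U))
        = (\<Sum>U\<in>Pow S. ennreal ((p * (x - 1)) ^ card U))"
      by (rule sum.cong[OF refl])
    then show ?thesis using assms by (subst (asm) sum_ennreal) auto
  qed
  also have "(\<Sum>U\<in>Pow S. (p * (x - 1)) ^ card U) = (1 + p * (x - 1)) ^ card S"
    using fin by (rule sum_power_card_Pow)
  finally show ?thesis .
qed

section \<open>Several rounds: backward induction\<close>

lemma IterSwR_rest_subset:
  assumes "IterSwR G ps D" "(As, R) \<in> set_pmf D"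
  shows "R \<subseteq> G"
  using assms by (induction arbitrary: As R rule: IterSwR.induct) (auto, blast)

text \<open>The base on the right is the moment generating function at \<open>ln c\<close> of the indicator that a
  fixed element is removed, if it survives round \<open>i\<close> with probability \<open>1 - p\<^sub>i\<close>.\<close>

lemma IterSwR_mgf_bound:
  assumes "IterSwR G ps D" "finite G" "S \<subseteq> G" "1 \<le> c" "\<forall>p\<in>set ps. 0 \<le> p \<and> p \<le> 1"
  shows "(\<integral>\<^sup>+(As, R). ennreal (c ^ card (S - R)) \<partial>D)
       \<le> ennreal ((c - (c - 1) * (\<Prod>p\<leftarrow>ps. 1 - p)) ^ card S)"
  using assms
\<comment> \<open>\<open>S\<close> varies because the later rounds are applied to the survivors
  \<open>S - returned t\<close>.\<close>
proof (induction arbitrary: S rule: IterSwR.induct)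
  case (finish G)
  then have "card (S - G) = 0" by (simp add: Diff_eq_empty_iff[THEN iffD2])
  then show ?case by simp
next
  case (round G p M ps K)
  define F where "F = c - (c - 1) * (\<Prod>p\<leftarrow>ps. 1 - p)"
  have P: "0 \<le> (\<Prod>p\<leftarrow>ps. 1 - p)" "(\<Prod>p\<leftarrow>ps. 1 - p) \<le> 1"
    using round.prems(4) by (induction ps) (auto intro!: mult_le_one)
  have F: "1 \<le> F" "F \<le> c"
    using P round.prems mult_left_le[of "\<Prod>p\<leftarrow>ps. 1 - p" "c - 1"] by (auto simp: F_def)
  have fin: "finite S" using round.prems finite_subset by blast
  \<comment> \<open>Removed elements have weight \<open>c\<close>, survivors weight \<open>F\<close>
    by the induction hypothesis. Taking out \<open>F ^ card S\<close> leaves \<open>c / F\<close>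
    per removed element, the form needed for the one-round bound.\<close>
  have step: "(\<integral>\<^sup>+(As, R). ennreal (c ^ card (S - R)) \<partial>map_pmf (\<lambda>(As, R). (returned t # As, R)) (K t))
      \<le> ennreal (F ^ card S) * ennreal ((c / F) ^ card (S \<inter> returned t))"
    if t: "t \<in> set_pmf M" for t
  proof -
    let ?A = "returned t"
    have "(\<integral>\<^sup>+(As, R). ennreal (c ^ card (S - R)) \<partial>map_pmf (\<lambda>(As, R). (?A # As, R)) (K t))
        = (\<integral>\<^sup>+(As, R). ennreal (c ^ card (S - R)) \<partial>K t)"
      by (simp add: case_prod_unfold)
    also have "\<dots> = (\<integral>\<^sup>+(As, R). ennreal (c ^ card (S \<inter> ?A)) * ennreal (c ^ card ((S - ?A) - R)) \<partial>K t)"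
    proof (intro nn_integral_cong_AE, unfold AE_measure_pmf_iff, clarify)
      fix As R assume "(As, R) \<in> set_pmf (K t)"
      then have "R \<subseteq> G - ?A" using IterSwR_rest_subset[OF round.hyps(2)[OF t]] by auto
      \<comment> \<open>Elements returned in this round never come back, so the removed part of
        \<open>S\<close> splits into this round's share and the later share.\<close>
      then have "S - R = (S \<inter> ?A) \<union> ((S - ?A) - R)" by auto
      then have "card (S - R) = card (S \<inter> ?A) + card ((S - ?A) - R)"
        using fin by (simp only:) (intro card_Un_disjoint, auto)
      then show "ennreal (c ^ card (S - R)) = ennreal (c ^ card (S \<inter> ?A)) * ennreal (c ^ card ((S - ?A) - R))"
        using round.prems by (simp add: power_add ennreal_mult)
    qed
    also have "\<dots> = ennreal (c ^ card (S \<inter> ?A)) * (\<integral>\<^sup>+(As, R). ennreal (c ^ card ((S - ?A) - R)) \<partial>K t)"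
      by (simp add: case_prod_unfold nn_integral_cmult)
    also have "\<dots> \<le> ennreal (c ^ card (S \<inter> ?A)) * ennreal (F ^ card (S - ?A))"
      unfolding F_def using round.prems by (intro mult_left_mono round.IH[OF t]) auto
    also have "\<dots> = ennreal (F ^ card S * (c / F) ^ card (S \<inter> ?A))"
    proof -
      have "card S = card (S \<inter> ?A) + card (S - ?A)" using fin by (rule card_Int_Diff)
      then have "F ^ card S * (c / F) ^ card (S \<inter> ?A) = c ^ card (S \<inter> ?A) * F ^ card (S - ?A)"
        using F by (simp add: power_add power_divide)
      then show ?thesis using F by (simp add: ennreal_mult)
    qed
    finally show ?thesis using F by (simp add: ennreal_mult)
  qed
  have "(\<integral>\<^sup>+(As, R). ennreal (c ^ card (S - R))
          \<partial>bind_pmf M (\<lambda>t. map_pmf (\<lambda>(As, R). (returned t # As, R)) (K t)))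
      = (\<integral>\<^sup>+t. (\<integral>\<^sup>+(As, R). ennreal (c ^ card (S - R)) \<partial>map_pmf (\<lambda>(As, R). (returned t # As, R)) (K t)) \<partial>M)"
    by (rule nn_integral_bind_pmf)
  also have "\<dots> \<le> (\<integral>\<^sup>+t. ennreal (F ^ card S) * ennreal ((c / F) ^ card (S \<inter> returned t)) \<partial>M)"
    using step by (intro nn_integral_mono_AE) (auto simp: AE_measure_pmf_iff)
  also have "\<dots> = ennreal (F ^ card S) * (\<integral>\<^sup>+t. ennreal ((c / F) ^ card (S \<inter> returned t)) \<partial>M)"
    by (simp add: nn_integral_cmult)
  also have "\<dots> \<le> ennreal (F ^ card S) * ennreal ((1 + p * (c / F - 1)) ^ card S)"
    using round.prems F by (intro mult_left_mono MSwR_mgf_bound[OF round.hyps(1)]) auto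
  also have "\<dots> = ennreal ((F * (1 + p * (c / F - 1))) ^ card S)"
    using F by (simp add: ennreal_mult' power_mult_distrib)
  \<comment> \<open>Both sides equal \<open>(1 - p) * F + p * c\<close>: an element survives this
    round with weight \<open>F\<close> or is removed with weight \<open>c\<close>.\<close>
  also have "F * (1 + p * (c / F - 1)) = c - (c - 1) * (\<Prod>p\<leftarrow>p # ps. 1 - p)"
  proof -
    have "F * (1 + p * (c / F - 1)) = (1 - p) * F + p * c" using F by (simp add: field_simps)
    then show ?thesis by (simp add: F_def algebra_simps)
  qed
  finally show ?case .
qed

section \<open>Elementary estimates\<close>

text \<open>The Weierstrass product inequality. It is a union bound in disguise: a chance
  \<open>1 - \<Prod>(1 - p)\<close> of removal is at most the sum of the \<open>p\<close>.\<close>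

lemma prod_list_one_minus_ge:
  fixes ps :: "real list"
  assumes "\<forall>p\<in>set ps. 0 \<le> p \<and> p \<le> 1"
  shows "1 - sum_list ps \<le> (\<Prod>p\<leftarrow>ps. 1 - p) \<and> (\<Prod>p\<leftarrow>ps. 1 - p) \<le> 1"
  using assms
proof (induction ps)
  case (Cons p ps)
  let ?P = "\<Prod>p\<leftarrow>ps. 1 - p"
  have "0 \<le> ?P" using Cons.prems by (induction ps) auto
  moreover have "p * ?P \<le> p" using Cons by (intro mult_left_le) auto
  moreover have "0 \<le> p * ?P" using Cons calculation(1) by simp
  moreover have "1 - sum_list ps \<le> ?P" "?P \<le> 1" using Cons by auto
  ultimately show ?case by (simp add: left_diff_distrib)
qed simp

text \<open>The difference of the two sides is 0 at \<open>e = 0\<close> and has derivative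
  \<open>ln (1 + e) - 2 / 3 * e\<close>, which is nonnegative on the unit interval.\<close>

lemma chernoff_exponent_bound:
  fixes e :: real
  assumes "0 \<le> e" "e \<le> 1"
  shows "e + e\<^sup>2 / 3 \<le> (1 + e) * ln (1 + e)"
proof -
  \<comment> \<open>By concavity \<open>ln\<close> lies above its chord from 1 to 2, whose slope
    \<open>ln 2\<close> is at least 2/3.\<close>
  have ln: "2 / 3 * x \<le> ln (1 + x)" if "0 \<le> x" "x \<le> 1" for x :: real
  proof -
    have "concave_on {0<..} (ln :: real \<Rightarrow> real)" by (rule ln_concave)
    from concave_onD[OF this, of x 1 2] have "x * ln 2 \<le> ln (1 + x)"
      using that by (simp add: algebra_simps)
    moreover have "x * (2 / 3) \<le> x * ln 2"
      using that ln2_ge_two_thirds by (intro mult_left_mono) auto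
    ultimately show ?thesis by simp
  qed
  have "(1 + 0) * ln (1 + 0) - 0 - 0\<^sup>2 / 3 \<le> (1 + e) * ln (1 + e) - e - e\<^sup>2 / 3"
  proof (rule DERIV_nonneg_imp_nondecreasing[OF assms(1)])
    fix x assume x: "0 \<le> x" "x \<le> e"
    have "((\<lambda>x. (1 + x) * ln (1 + x) - x - x\<^sup>2 / 3) has_real_derivative ln (1 + x) - 2 / 3 * x) (at x)"
      using x by (auto intro!: derivative_eq_intros)
    then show "\<exists>y. ((\<lambda>x. (1 + x) * ln (1 + x) - x - x\<^sup>2 / 3) has_real_derivative y) (at x) \<and> 0 \<le> y"
      using ln[of x] x assms by auto
  qed
  then show ?thesis by simp
qed

section \<open>The tail bound\<close>

theorem theorem3p6:
  fixes G S :: "'a set" and ps :: "real list" and \<mu> \<epsilon> :: real and m m' n :: nat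
    and D :: "('a set list \<times> 'a set) pmf"
  assumes "finite G" and "card G = m"
    and "S \<subseteq> G" and "card S = m'"
    and "length ps = n" and "\<forall>p \<in> set ps. 0 < p \<and> p < 1"
    and "IterSwR G ps D"
    and "\<mu> = (\<Sum>i<n. ps ! i)"
    and "0 \<le> \<epsilon>" and "\<epsilon> \<le> 1"
  shows "measure_pmf.prob D {(As, R). real (card (S - R)) > (1 + \<epsilon>) * \<mu> * real m'}
           \<le> exp (- (1/3) * \<epsilon>^2 * \<mu> * real m')"
proof -
  \<comment> \<open>This \<open>c\<close> minimizes the Chernoff bound \<open>exp ((c - 1) * \<mu> *
    m') / c powr ((1 + \<epsilon>) * \<mu> * m')\<close>.\<close>
  define c where "c = 1 + \<epsilon>"
  define X where "X = {(As :: 'a set list, R). real (card (S - R)) > c * \<mu> * real m'}"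
  define P where "P = (\<Prod>p\<leftarrow>ps. 1 - p)"
  have c: "1 \<le> c" using assms by (simp add: c_def)
  have ps: "\<forall>p\<in>set ps. 0 \<le> p \<and> p \<le> 1" using assms by auto
  have \<mu>: "\<mu> = sum_list ps" using assms by (simp add: sum_list_sum_nth atLeast0LessThan)
  then have \<mu>0: "0 \<le> \<mu>" using ps by (simp add: sum_list_nonneg)
  have P: "1 - \<mu> \<le> P" "P \<le> 1" using prod_list_one_minus_ge[OF ps] by (auto simp: P_def \<mu>)
  have "c - (c - 1) * P = 1 + \<epsilon> * (1 - P)" by (simp add: c_def algebra_simps)
  also have "\<dots> \<le> 1 + \<epsilon> * \<mu>" using P assms by (intro add_left_mono mult_left_mono) auto
  also have "\<dots> \<le> exp (\<epsilon> * \<mu>)" by (rule exp_ge_add_one_self)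
  finally have base: "c - (c - 1) * P \<le> exp (\<epsilon> * \<mu>)" .
  have base0: "0 \<le> c - (c - 1) * P"
    using c P mult_left_le[of P "c - 1"] by auto
  \<comment> \<open>Markov's inequality for \<open>c ^ card (S - R)\<close>; \<open>powr\<close> is
    used since the threshold need not be an integer.\<close>
  have "ennreal (c powr (c * \<mu> * m')) * emeasure D X
      = (\<integral>\<^sup>+z. ennreal (c powr (c * \<mu> * m')) * indicator X z \<partial>D)"
    by (simp add: nn_integral_cmult_indicator)
  also have "\<dots> \<le> (\<integral>\<^sup>+(As, R). ennreal (c ^ card (S - R)) \<partial>D)"
  proof (intro nn_integral_mono, clarify)
    fix As R
    have "c powr (c * \<mu> * m') \<le> c ^ card (S - R)" if "(As, R) \<in> X"
      using that c powr_mono[of "c * \<mu> * m'" "card (S - R)" c] by (simp add: X_def powr_realpow)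
    then show "ennreal (c powr (c * \<mu> * m')) * indicator X (As, R) \<le> ennreal (c ^ card (S - R))"
      by (auto simp: indicator_def intro: ennreal_leI)
  qed
  also have "\<dots> \<le> ennreal ((c - (c - 1) * P) ^ m')"
    using IterSwR_mgf_bound[OF assms(7,1,3) c ps] assms by (simp add: P_def)
  also have "\<dots> \<le> ennreal (exp (\<epsilon> * \<mu>) ^ m')"
    using base base0 by (intro ennreal_leI power_mono)
  finally have "c powr (c * \<mu> * m') * measure_pmf.prob D X \<le> exp (\<epsilon> * \<mu>) ^ m'"
    by (simp add: measure_pmf.emeasure_eq_measure ennreal_mult[symmetric])
  then have "measure_pmf.prob D X \<le> exp (\<epsilon> * \<mu>) ^ m' / c powr (c * \<mu> * m')"
    using c by (simp add: field_simps)
  also have "\<dots> = exp (\<mu> * m' * (\<epsilon> - c * ln c))"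
    using c by (simp add: powr_def exp_of_nat_mult[symmetric] exp_diff[symmetric] algebra_simps)
  also have "\<dots> \<le> exp (\<mu> * m' * (- (\<epsilon>\<^sup>2 / 3)))"
  proof -
    have "\<epsilon> - c * ln c \<le> - (\<epsilon>\<^sup>2 / 3)"
      using chernoff_exponent_bound[OF assms(9,10)] by (simp add: c_def)
    then show ?thesis using \<mu>0 by (simp only: exp_le_cancel_iff) (intro mult_left_mono, auto)
  qed
  finally show ?thesis by (simp add: X_def c_def algebra_simps)
qed

end
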